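(* Let $k\ge1$ be an integer, $a\in\mathbb{C}$, and $\mathfrak{S}=\{x\in\mathbb{C}: -1\le \operatorname{Im}(x)\le 0\}$. Let $F$ be a complex function analytic on an open set containing $\{a\,x(x+i): x\in\mathfrak{S}\}$ such that $F(a\,x(x+i))=o\!\left(e^{\pi|x|}/|x|\right)$ uniformly for $x\in\mathfrak{S}$ as $\operatorname{Re}(x)\to\pm\infty$, and such that $F(a\,x(x+i))\to0$ as $x\to0$. Then $$\int_{-\infty}^{\infty}\frac{F(a\,x(i+x))}{\sinh(2k\pi(i+x))}\,dx=\int_{-\infty}^{\infty}\frac{F(a\,x(i+x))}{\sinh(2k\pi x)}\,dx=-\frac{i(-1)^k}{k}\left(\sum_{n=1}^{k-1}(-1)^nF(x_n)+\frac12F(a/4)\right),$$ where $x_n=\dfrac{a\,(k^2-n^2)}{4k^2}$.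
   Context: Integrals over the real line are understood as $\lim_{R\to\infty}\int_{-R}^{R}$ (the removable singularity at $x=0$ being filled in). An empty sum is $0$. *)

theory Defs
  imports "HOL-Complex_Analysis.Complex_Analysis" "HOL-Library.Landau_Symbols"
begin

definition strip :: "complex set" where
  "strip = {x. - 1 \<le> Im x \<and> Im x \<le> 0}"

(* Re x tends to plus or minus infinity with x confined to the strip; since the threshold on
   |Re x| does not depend on Im x, Landau symbols for this filter are uniform over the strip. *)
definition strip_ends :: "complex filter" where
  "strip_ends = inf (filtercomap (\<lambda>x. \<bar>Re x\<bar>) at_top) (principal strip)"

(* The integral over the real line as the limit of integrals over {-R..R}. Integrability is
   required separately because integral returns 0 on non-integrable functions; remove_sings
   replaces the value of f at a removable singularity by its limit there. *)
definition has_line_integral :: "(complex \<Rightarrow> complex) \<Rightarrow> complex \<Rightarrow> bool" where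
  "has_line_integral f I \<longleftrightarrow>
     (\<forall>R>0. (\<lambda>t::real. remove_sings f (of_real t)) integrable_on {-R..R}) \<and>
     ((\<lambda>R. integral {-R..R} (\<lambda>t::real. remove_sings f (of_real t))) \<longlongrightarrow> I) at_top"

end

theory Submission
  imports Defs
begin

text \<open>
  Put \<open>f(z) = F(a z (z + i))\<close>, which is analytic near the strip, and
  \<open>g(z) = f(z) / sinh(2 k \<pi> z)\<close>. Both integrands equal \<open>g\<close>, because \<open>sinh\<close> has period
  \<open>2 \<pi> i\<close>. The product \<open>z (z + i)\<close> is invariant under the point reflection
  \<open>z \<mapsto> - i - z\<close>, which exchanges the two edges of the strip, while \<open>sinh(2 k \<pi> z)\<close>
  changes sign; so \<open>g(- i - z) = - g(z)\<close>. Hence the two horizontal sides of the rectangle with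
  vertices \<open>\<plusminus>R\<close> and \<open>\<plusminus>R - i\<close> contribute equally to the contour integral of \<open>g\<close>, namely
  each minus the integral over \<open>{-R..R}\<close>. On the vertical sides \<open>g\<close> tends to 0, since
  \<open>f(z) = o(exp(\<pi> \<bar>z\<bar>) / \<bar>z\<bar>)\<close> and \<open>sinh(2 k \<pi> z)\<close> grows at least like
  \<open>exp(\<pi> \<bar>Re z\<bar>)\<close> (\<open>quotient_sinh_tendsto_0\<close>). The residue theorem therefore gives
  \<open>- \<pi> i\<close> times the sum of the residues inside the strip; this is \<open>strip_integral\<close>, stated for
  any function with this antisymmetry that vanishes at the ends.

  The zeros of \<open>sinh(2 k \<pi> z)\<close> in the strip are \<open>p\<^sub>m = - i m / (2 k)\<close> for \<open>0 \<le> m \<le> 2 k\<close>,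
  and they are simple. At the two on the edges, \<open>m = 0\<close> and \<open>m = 2 k\<close>, the singularity of \<open>g\<close>
  is removable because \<open>f(0) = 0\<close>. At the others the residue is
  \<open>(-1)\<^sup>m f(p\<^sub>m) / (2 k \<pi>)\<close>. Writing \<open>m = k \<plusminus> n\<close> one finds
  \<open>p\<^sub>m (p\<^sub>m + i) = (k\<^sup>2 - n\<^sup>2) / (4 k\<^sup>2)\<close>, so the residues for \<open>k + n\<close> and \<open>k - n\<close>
  coincide, which leaves each \<open>F(x\<^sub>n)\<close> with \<open>n \<ge> 1\<close> twice and \<open>F(a/4)\<close> once.
\<close>

section \<open>Integrals of antisymmetric functions along the edge of the strip\<close>

lemma eventually_strip_ends:
  "eventually P strip_ends \<longleftrightarrow> (\<exists>R. \<forall>z\<in>strip. R \<le> \<bar>Re z\<bar> \<longrightarrow> P z)"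
  unfolding strip_ends_def eventually_inf_principal eventually_filtercomap_at_top_linorder
  by auto

lemma convex_strip: "convex strip"
proof -
  have "strip = {x. Im x \<ge> -1} \<inter> {x. Im x \<le> 0}" by (auto simp: strip_def)
  then show ?thesis
    by (metis convex_Int convex_halfspace_Im_ge convex_halfspace_Im_le)
qed

text \<open>
  The reflection \<open>z \<mapsto> - i - z\<close> maps the lower edge, run from left to right, to the upper edge,
  run from right to left. It reverses \<open>dz\<close>, and the antisymmetry of \<open>h\<close> compensates the sign.
\<close>
lemma contour_integral_strip_edges:
  fixes h :: "complex \<Rightarrow> complex"
  assumes anti: "\<And>t::real. h (of_real t - \<i>) = - h (of_real (- t))"
  shows "contour_integral (linepath (Complex (-R) (-1)) (Complex R (-1))) h =
         contour_integral (linepath (of_real R) (of_real (-R))) h"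
proof -
  have *: "h (linepath (Complex (-R) (-1)) (Complex R (-1)) x) =
           - h (linepath (of_real R) (of_real (-R)) x)" for x
  proof -
    have "linepath (Complex (-R) (-1)) (Complex R (-1)) x = of_real (2 * R * x - R) - \<i>"
      "linepath (of_real R) (of_real (-R)) x = complex_of_real (- (2 * R * x - R))"
      by (auto simp: linepath_def complex_eq_iff algebra_simps)
    then show ?thesis using anti by metis
  qed
  have d: "Complex R (-1) - Complex (-R) (-1) = of_real (2 * R)"
    by (auto simp: complex_eq_iff)
  show ?thesis
    unfolding contour_integral_integral vector_derivative_linepath_at d *
    by (simp add: mult_ac)
qed

text \<open>
  The residue theorem on rectangles of height 1. Truncations to \<open>{-R..R}\<close> are evaluated exactly
  up to half the contribution of the vertical sides, and the decay at the ends makes that vanish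
  as \<open>R \<rightarrow> \<infinity>\<close>.
\<close>
lemma strip_integral:
  fixes h :: "complex \<Rightarrow> complex"
  assumes "open D" "strip \<subseteq> D" "finite P" "h holomorphic_on D - P"
    and P: "\<And>p. p \<in> P \<Longrightarrow> Re p = 0 \<and> -1 < Im p \<and> Im p < 0"
    and anti: "\<And>t::real. h (of_real t - \<i>) = - h (of_real (- t))"
    and ends: "(h \<longlongrightarrow> 0) strip_ends"
  shows "\<And>R. R > 0 \<Longrightarrow> (\<lambda>t::real. h (of_real t)) integrable_on {-R..R}"
    and "((\<lambda>R. integral {-R..R} (\<lambda>t::real. h (of_real t))) \<longlongrightarrow>
           - (of_real pi * \<i> * (\<Sum>p\<in>P. residue h p))) at_top"
proof -
  \<comment> \<open>\<open>D\<close> may be disconnected, but the strip lies in one component.\<close>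
  define C where "C = connected_component_set D 0"
  have "0 \<in> strip" by (simp add: strip_def)
  have "strip \<subseteq> C" unfolding C_def
    by (intro connected_component_maximal convex_connected convex_strip assms \<open>0 \<in> strip\<close>)
  have "open C" "connected C" "C \<subseteq> D"
    unfolding C_def using \<open>open D\<close>
    by (auto simp: open_connected_component connected_component_subset)
  have holC: "h holomorphic_on C - P"
    using assms(4) \<open>C \<subseteq> D\<close> by (meson Diff_mono holomorphic_on_subset order_refl)
  have cont: "continuous_on S h" if "S \<subseteq> strip" "S \<inter> P = {}" for S
    by (intro holomorphic_on_imp_continuous_on holomorphic_on_subset[OF holC])
       (use that \<open>strip \<subseteq> C\<close> in auto)
  have eq: "2 * integral {-R..R} (\<lambda>t::real. h (of_real t)) =
        (contour_integral (linepath (Complex R (-1)) (Complex R 0)) h +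
         contour_integral (linepath (Complex (-R) 0) (Complex (-R) (-1))) h)
         - 2 * of_real pi * \<i> * (\<Sum>p\<in>P. residue h p)"
    and int: "(\<lambda>t::real. h (of_real t)) integrable_on {-R..R}"
    and int1: "h contour_integrable_on linepath (Complex R (-1)) (Complex R 0)"
    and int2: "h contour_integrable_on linepath (Complex (-R) 0) (Complex (-R) (-1))"
    if R: "R > 0" for R
  proof -
    let ?a = "Complex (-R) (-1)" and ?b = "Complex R 0"
    let ?\<gamma> = "rectpath ?a ?b"
    have box: "cbox ?a ?b \<subseteq> strip" by (auto simp: in_cbox_complex_iff strip_def)
    have Pbox: "P \<subseteq> box ?a ?b" using P R by (auto simp: in_box_complex_iff)
    have img: "path_image ?\<gamma> = cbox ?a ?b - box ?a ?b"
      using R by (intro path_image_rectpath_cbox_minus_box) auto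
    have seg: "continuous_on (path_image ?\<gamma>) h"
      by (intro cont) (use box Pbox img in auto)
    have imgs: "path_image ?\<gamma> = closed_segment ?a (Complex R (-1)) \<union>
       closed_segment (Complex R (-1)) ?b \<union> closed_segment ?b (Complex (-R) 0) \<union>
       closed_segment (Complex (-R) 0) ?a"
      by (auto simp: rectpath_def Let_def path_image_join)
    have ints: "h contour_integrable_on linepath ?a (Complex R (-1))"
      "h contour_integrable_on linepath (Complex R (-1)) ?b"
      "h contour_integrable_on linepath ?b (Complex (-R) 0)"
      "h contour_integrable_on linepath (Complex (-R) 0) ?a"
      by (intro contour_integrable_continuous_linepath continuous_on_subset[OF seg];
          simp add: imgs subset_eq)+
    then show "h contour_integrable_on linepath (Complex R (-1)) ?b"
      "h contour_integrable_on linepath (Complex (-R) 0) ?a" by auto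
    have "contour_integral ?\<gamma> h =
       2 * pi * \<i> * (\<Sum>p\<in>P. winding_number ?\<gamma> p * residue h p)"
    proof (rule Residue_theorem[OF \<open>open C\<close> \<open>connected C\<close> \<open>finite P\<close> holC])
      show "path_image ?\<gamma> \<subseteq> C - P" using img box Pbox \<open>strip \<subseteq> C\<close> by blast
      show "\<forall>z. z \<notin> C \<longrightarrow> winding_number ?\<gamma> z = 0"
        using box \<open>strip \<subseteq> C\<close> R by (auto intro!: winding_number_rectpath_outside)
    qed auto
    also have "(\<Sum>p\<in>P. winding_number ?\<gamma> p * residue h p) = (\<Sum>p\<in>P. residue h p)"
      by (intro sum.cong refl) (use Pbox in \<open>auto simp: winding_number_rectpath subset_eq\<close>)
    also have "contour_integral ?\<gamma> h =
       contour_integral (linepath ?a (Complex R (-1))) h +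
       (contour_integral (linepath (Complex R (-1)) ?b) h +
       (contour_integral (linepath ?b (Complex (-R) 0)) h +
       contour_integral (linepath (Complex (-R) 0) ?a) h))"
      using ints by (simp add: rectpath_def Let_def contour_integrable_joinI)
    also have "contour_integral (linepath ?a (Complex R (-1))) h =
       contour_integral (linepath ?b (Complex (-R) 0)) h"
      using contour_integral_strip_edges[OF anti] by (simp add: complex_of_real_def)
    finally have 1: "2 * contour_integral (linepath ?b (Complex (-R) 0)) h =
       2 * of_real pi * \<i> * (\<Sum>p\<in>P. residue h p) -
       (contour_integral (linepath (Complex R (-1)) ?b) h +
        contour_integral (linepath (Complex (-R) 0) ?a) h)"
      by (simp add: algebra_simps)
    have ct: "continuous_on (closed_segment ?b (Complex (-R) 0)) h"
      using continuous_on_subset[OF seg] imgs by blast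
    have 2: "contour_integral (linepath ?b (Complex (-R) 0)) h =
       - contour_integral (linepath (Complex (-R) 0) ?b) h"
      using contour_integral_reverse_linepath[OF ct] by simp
    have re: "Complex (-R) 0 \<in> \<real>" "?b \<in> \<real>" "Re (Complex (-R) 0) < Re ?b"
      using R by (auto simp: complex_is_Real_iff)
    show "2 * integral {-R..R} (\<lambda>t::real. h (of_real t)) =
        (contour_integral (linepath (Complex R (-1)) (Complex R 0)) h +
         contour_integral (linepath (Complex (-R) 0) (Complex (-R) (-1))) h)
         - 2 * of_real pi * \<i> * (\<Sum>p\<in>P. residue h p)"
      using 1 2 contour_integral_linepath_Reals_eq[OF re, of h] by (simp add: algebra_simps)
    have "h contour_integrable_on linepath (Complex (-R) 0) ?b"
      by (intro contour_integrable_continuous_linepath) (metis ct closed_segment_commute)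
    then show "(\<lambda>t::real. h (of_real t)) integrable_on {-R..R}"
      using contour_integrable_linepath_Reals_iff[OF re, of h] by simp
  qed
  show "\<And>R. R > 0 \<Longrightarrow> (\<lambda>t::real. h (of_real t)) integrable_on {-R..R}" by (fact int)
  define S where "S R = contour_integral (linepath (Complex R (-1)) (Complex R 0)) h +
         contour_integral (linepath (Complex (-R) 0) (Complex (-R) (-1))) h" for R
  have S0: "(S \<longlongrightarrow> 0) at_top"
  proof (rule tendstoI)
    fix e :: real assume "e > 0"
    then have "eventually (\<lambda>z. dist (h z) 0 < e/4) strip_ends"
      using ends by (intro tendstoD) auto
    then obtain X where X: "\<And>z. z \<in> strip \<Longrightarrow> X \<le> \<bar>Re z\<bar> \<Longrightarrow> norm (h z) < e/4"
      by (auto simp: eventually_strip_ends)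
    have B: "norm (contour_integral (linepath u v) h) \<le> e/4 * norm (v - u)"
      if "h contour_integrable_on linepath u v" and
        "closed_segment u v \<subseteq> strip \<inter> {z. X \<le> \<bar>Re z\<bar>}" for u v
      using that \<open>e > 0\<close> by (intro contour_integral_bound_linepath less_imp_le[OF X]) auto
    have "dist (S R) 0 < e" if "R > max X 0" for R
    proof -
      have b1: "norm (contour_integral (linepath (Complex R (-1)) (Complex R 0)) h)
             \<le> e/4 * norm (Complex R 0 - Complex R (-1))"
        using that
        by (intro B int1) (auto simp: closed_segment_same_Re closed_segment_eq_real_ivl strip_def)
      have b2: "norm (contour_integral (linepath (Complex (-R) 0) (Complex (-R) (-1))) h)
             \<le> e/4 * norm (Complex (-R) (-1) - Complex (-R) 0)"
        using that
        by (intro B int2) (auto simp: closed_segment_same_Re closed_segment_eq_real_ivl strip_def)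
      have n: "norm (Complex R 0 - Complex R (-1)) = 1"
        "norm (Complex (-R) (-1) - Complex (-R) 0) = 1"
        by (auto simp: cmod_def)
      have "norm (S R) \<le> e/4 + e/4"
        unfolding S_def using b1 b2 n by (intro norm_triangle_mono) auto
      then show ?thesis using \<open>e > 0\<close> by simp
    qed
    then show "eventually (\<lambda>R. dist (S R) 0 < e) at_top"
      using eventually_gt_at_top by (rule eventually_mono[rotated])
  qed
  have "((\<lambda>R. S R / 2 - of_real pi * \<i> * (\<Sum>p\<in>P. residue h p)) \<longlongrightarrow>
     0 / 2 - of_real pi * \<i> * (\<Sum>p\<in>P. residue h p)) at_top"
    by (intro tendsto_intros S0) auto
  moreover have "eventually (\<lambda>R. S R / 2 - of_real pi * \<i> * (\<Sum>p\<in>P. residue h p) =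
      integral {-R..R} (\<lambda>t::real. h (of_real t))) at_top"
    using eventually_gt_at_top[of 0]
  proof eventually_elim
    case (elim R)
    show ?case using eq[OF elim] unfolding S_def by (simp add: field_simps)
  qed
  ultimately show "((\<lambda>R. integral {-R..R} (\<lambda>t::real. h (of_real t))) \<longlongrightarrow>
           - (of_real pi * \<i> * (\<Sum>p\<in>P. residue h p))) at_top"
    using tendsto_cong by force
qed

section \<open>Zeros and growth of the hyperbolic sine\<close>

lemma sinh_eq_0_iff:
  fixes k :: nat and z :: complex
  assumes "k \<ge> 1"
  shows "sinh (2 * of_nat k * of_real pi * z) = 0 \<longleftrightarrow>
         (\<exists>m::int. z = \<i> * of_int m / (2 * of_nat k))"
proof -
  have "sinh (2 * of_nat k * of_real pi * z) = 0 \<longleftrightarrow>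
     (\<exists>m::int. \<i> * (2 * of_nat k * of_real pi * z) = of_real (of_int m * pi))"
    by (simp add: sinh_conv_sin sin_eq_0)
  also have "\<dots> \<longleftrightarrow> (\<exists>m::int. z = - (\<i> * of_int m / (2 * of_nat k)))"
  proof (intro ex_cong1)
    fix m :: int
    have "\<i> * (2 * of_nat k * of_real pi * z) = of_real (of_int m * pi) \<longleftrightarrow>
       complex_of_real pi * (2 * of_nat k * \<i> * z) = of_real pi * of_int m"
      by (simp add: mult_ac)
    also have "\<dots> \<longleftrightarrow> 2 * of_nat k * \<i> * z = of_int m"
      by (simp only: mult_cancel_left of_real_eq_0_iff pi_neq_zero simp_thms)
    also have "\<dots> \<longleftrightarrow> z = - (\<i> * of_int m / (2 * of_nat k))"
      using assms by (auto simp: field_simps complex_eq_iff)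
    finally show "\<i> * (2 * of_nat k * of_real pi * z) = of_real (of_int m * pi) \<longleftrightarrow>
       z = - (\<i> * of_int m / (2 * of_nat k))" .
  qed
  also have "\<dots> \<longleftrightarrow> (\<exists>m::int. z = \<i> * of_int m / (2 * of_nat k))"
    by (metis (no_types, opaque_lifting) minus_divide_left mult_minus_right of_int_minus
        minus_minus)
  finally show ?thesis .
qed

lemma cosh_at_zero_of_sinh:
  assumes "k \<ge> 1"
  shows "cosh (2 * of_nat k * of_real pi * (- (\<i> * of_nat m / (2 * of_nat k)))) =
         ((-1) ^ m :: complex)"
proof -
  have "\<i> * (2 * of_nat k * of_real pi * (- (\<i> * of_nat m / (2 * of_nat k))))
     = complex_of_real (of_nat m * pi)" using assms by (simp add: field_simps)
  then have "cosh (2 * of_nat k * of_real pi * (- (\<i> * of_nat m / (2 * of_nat k)))) =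
     cos (complex_of_real (of_nat m * pi))"
    by (simp only: cosh_conv_cos)
  also have "\<dots> = complex_of_real (cos (of_nat m * pi))" by (simp only: cos_of_real)
  finally show ?thesis by (simp add: cos_npi)
qed

text \<open>
  Multiplied by \<open>f(z)\<close>, this limit gives the residues of \<open>f(z) / sinh(c z)\<close>; multiplied by
  \<open>f(z) / z\<close> with \<open>f(0) = 0\<close>, it shows that the singularity at 0 is removable.
\<close>
lemma sinh_simple_zero:
  fixes c p :: complex
  assumes "c \<noteq> 0" "sinh (c * p) = 0"
  shows "(\<lambda>z. (z - p) / sinh (c * z)) \<midarrow>p\<rightarrow> 1 / (c * cosh (c * p))"
proof -
  have "cosh (c * p) \<noteq> 0"
    using cosh_square_eq[of "c * p"] assms(2) by auto
  have "((\<lambda>z. sinh (c * z)) has_field_derivative c * cosh (c * p)) (at p)"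
    by (auto intro!: derivative_eq_intros)
  then have "(\<lambda>z. sinh (c * z) / (z - p)) \<midarrow>p\<rightarrow> c * cosh (c * p)"
    by (simp add: has_field_derivative_iff assms(2))
  then have "(\<lambda>z. inverse (sinh (c * z) / (z - p))) \<midarrow>p\<rightarrow> inverse (c * cosh (c * p))"
    using assms(1) \<open>cosh (c * p) \<noteq> 0\<close> by (intro tendsto_inverse) auto
  then show ?thesis by (simp add: field_simps)
qed

lemma norm_sinh_ge:
  fixes z :: complex
  shows "norm (sinh z) \<ge> sinh \<bar>Re z\<bar>"
proof -
  have "\<bar>norm (exp z) - norm (exp (-z))\<bar> \<le> norm (exp z - exp (-z))"
    by (rule norm_triangle_ineq3)
  then have "\<bar>sinh (Re z)\<bar> \<le> norm (sinh z)"
    by (simp add: sinh_field_def norm_divide)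
  then show ?thesis by (cases "Re z \<ge> 0") (auto)
qed

text \<open>
  On the strip \<open>\<bar>z\<bar> \<le> \<bar>Re z\<bar> + 1\<close>, so a bound in terms of \<open>exp(\<pi> \<bar>z\<bar>)\<close> costs only a factor
  \<open>exp \<pi>\<close> compared with \<open>exp(\<pi> \<bar>Re z\<bar>)\<close>, which the hyperbolic sine dominates.
\<close>
lemma quotient_sinh_tendsto_0:
  fixes f :: "complex \<Rightarrow> complex"
  assumes k: "k \<ge> 1" and small: "f \<in> o[strip_ends](\<lambda>x. of_real (exp (pi * norm x) / norm x))"
  shows "((\<lambda>z. f z / sinh (2 * of_nat k * of_real pi * z)) \<longlongrightarrow> 0) strip_ends"
proof (rule Lim_null_comparison)
  let ?e = "\<lambda>x::complex. of_real (exp (pi * norm x) / norm x) :: complex"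
  have "((\<lambda>x. f x / ?e x) \<longlongrightarrow> 0) strip_ends"
    using small by (rule smalloD_tendsto)
  from tendsto_mult_right_zero[OF tendsto_norm_zero[OF this]]
  show "((\<lambda>x. 4 * exp pi * norm (f x / ?e x)) \<longlongrightarrow> 0) strip_ends" .
  have "norm (f z / sinh (2 * of_nat k * of_real pi * z)) \<le> 4 * exp pi * norm (f z / ?e z)"
    if z: "z \<in> strip" "1 \<le> \<bar>Re z\<bar>" for z
  proof -
    let ?x = "\<bar>Re z\<bar>"
    have "norm z \<ge> 1" using z abs_Re_le_cmod[of z] by linarith
    have "norm z \<le> ?x + 1"
      using cmod_le[of z] z by (auto simp: strip_def)
    have "exp (pi * norm z) / norm z \<le> exp (pi * norm z) / 1"
      using \<open>norm z \<ge> 1\<close> by (intro divide_left_mono) auto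
    also have "\<dots> \<le> exp (pi * (?x + 1))"
      using \<open>norm z \<le> ?x + 1\<close> by simp
    also have "\<dots> = exp pi * exp (pi * ?x)" by (simp add: exp_add algebra_simps)
    also have "exp (pi * ?x) \<le> 4 * sinh (pi * ?x)"
    proof -
      have "1 * 1 \<le> pi * ?x" using z pi_gt3 by (intro mult_mono) auto
      then have "2 \<le> exp (pi * ?x)" using exp_ge_add_one_self[of "pi * ?x"] by linarith
      moreover have "exp (- (pi * ?x)) \<le> 1" by simp
      moreover have "4 * sinh (pi * ?x) = 2 * exp (pi * ?x) - 2 * exp (- (pi * ?x))"
        by (simp add: sinh_field_def)
      ultimately show ?thesis by linarith
    qed
    also have "sinh (pi * ?x) \<le> sinh (2 * of_nat k * pi * ?x)"
    proof -
      have "1 * (pi * ?x) \<le> (2 * of_nat k) * (pi * ?x)"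
        using k by (intro mult_right_mono) auto
      then show ?thesis by (simp add: mult.assoc)
    qed
    also have "\<dots> \<le> norm (sinh (2 * of_nat k * of_real pi * z))"
      using norm_sinh_ge[of "2 * of_nat k * of_real pi * z"] k
      by (simp add: abs_mult)
    finally have b: "exp (pi * norm z) / norm z \<le>
       4 * exp pi * norm (sinh (2 * of_nat k * of_real pi * z))" by simp
    moreover have "exp (pi * norm z) / norm z > 0" using \<open>norm z \<ge> 1\<close> by (intro divide_pos_pos) auto
    ultimately have "norm (sinh (2 * of_nat k * of_real pi * z)) > 0"
      by (metis less_le_trans zero_less_mult_pos exp_gt_zero zero_less_numeral mult_pos_pos)
    define E T where "E = exp (pi * norm z) / norm z"
      and "T = norm (sinh (2 * of_nat k * of_real pi * z))"
    have "E > 0" "T > 0" "E \<le> 4 * exp pi * T"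
      using b \<open>norm (sinh (2 * of_nat k * of_real pi * z)) > 0\<close>
        \<open>exp (pi * norm z) / norm z > 0\<close> by (simp_all only: E_def T_def)
    then have "1 / T \<le> 4 * exp pi / E" by (simp add: field_simps)
    then have "norm (f z) * (1 / T) \<le> norm (f z) * (4 * exp pi / E)"
      by (intro mult_left_mono) auto
    moreover have "norm (?e z) = E"
      using \<open>E > 0\<close> unfolding norm_of_real by (simp add: E_def)
    ultimately show ?thesis
      unfolding norm_divide T_def[symmetric] by (simp add: mult_ac)
  qed
  then show "eventually (\<lambda>z. norm (f z / sinh (2 * of_nat k * of_real pi * z)) \<le>
     4 * exp pi * norm (f z / ?e z)) strip_ends"
    unfolding eventually_strip_ends by blast
qed

section \<open>Evaluation of the integral\<close>

lemma sum_alternating_symmetric: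
  fixes c :: "nat \<Rightarrow> complex"
  assumes "k \<ge> 1" and sym: "\<And>n. n < k \<Longrightarrow> c (k - n) = c (k + n)"
  shows "(\<Sum>m=1..2*k-1. (-1) ^ m * c m) =
         (-1) ^ k * (c k + 2 * (\<Sum>n=1..k-1. (-1) ^ n * c (k + n)))"
proof -
  have split: "{1..2*k-1} = {1..k-1} \<union> ({k} \<union> {k+1..2*k-1})" using assms(1) by auto
  have "(\<Sum>m=1..2*k-1. (-1) ^ m * c m) =
     (\<Sum>m=1..k-1. (-1) ^ m * c m) + ((-1) ^ k * c k + (\<Sum>m=k+1..2*k-1. (-1) ^ m * c m))"
    unfolding split by (subst sum.union_disjoint; auto)+
  also have "(\<Sum>m=1..k-1. (-1) ^ m * c m) = (\<Sum>n=1..k-1. (-1) ^ (k - n) * c (k - n))"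
    by (rule sum.reindex_bij_witness[of _ "\<lambda>n. k - n" "\<lambda>n. k - n"]) auto
  also have "\<dots> = (\<Sum>n=1..k-1. (-1) ^ k * ((-1) ^ n * c (k + n)))"
  proof (intro sum.cong refl)
    fix n assume "n \<in> {1..k-1}"
    then have "n < k" by auto
    then have "(-1) ^ (k - n) = (-1 :: complex) ^ k * (-1) ^ n"
      by (auto simp: minus_one_power_iff)
    then show "(-1) ^ (k - n) * c (k - n) = (-1) ^ k * ((-1) ^ n * c (k + n))"
      using sym[OF \<open>n < k\<close>] by simp
  qed
  also have "(\<Sum>m=k+1..2*k-1. (-1) ^ m * c m) = (\<Sum>n=1..k-1. (-1) ^ (k + n) * c (k + n))"
    by (rule sum.reindex_bij_witness[of _ "\<lambda>n. k + n" "\<lambda>m. m - k"]) auto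
  also have "\<dots> = (\<Sum>n=1..k-1. (-1) ^ k * ((-1) ^ n * c (k + n)))"
    by (simp add: power_add mult.assoc)
  finally show ?thesis by (simp add: sum_distrib_left algebra_simps)
qed

theorem mainTheorem8:
  fixes k :: nat and a :: complex and F :: "complex \<Rightarrow> complex" and U :: "complex set"
  assumes "k \<ge> 1"
    and "open U" and "(\<lambda>x. a * x * (x + \<i>)) ` strip \<subseteq> U" and "F analytic_on U"
    and "(\<lambda>x. F (a * x * (x + \<i>))) \<in> o[strip_ends](\<lambda>x. of_real (exp (pi * norm x) / norm x))"
    and "((\<lambda>x. F (a * x * (x + \<i>))) \<longlongrightarrow> 0) (at 0 within strip)"
  shows "let V = - (\<i> * (-1) ^ k / of_nat k) *
           ((\<Sum>n=1..k-1. (-1) ^ n * F (a * ((of_nat k)\<^sup>2 - (of_nat n)\<^sup>2) / (4 * (of_nat k)\<^sup>2)))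
             + 1 / 2 * F (a / 4))
         in has_line_integral
              (\<lambda>x. F (a * x * (\<i> + x)) / sinh (2 * of_nat k * of_real pi * (\<i> + x))) V \<and>
            has_line_integral
              (\<lambda>x. F (a * x * (\<i> + x)) / sinh (2 * of_nat k * of_real pi * x)) V"
proof -
  note k = assms(1) and U = assms(2) and img = assms(3) and F = assms(4)
  define f where "f z = F (a * z * (z + \<i>))" for z
  define c where "c = 2 * of_nat k * complex_of_real pi"
  define g where "g z = f z / sinh (c * z)" for z
  define h where "h = remove_sings g"
  define p where "p m = - (\<i> * of_nat m / (2 * of_nat k))" for m :: nat
  define P where "P = p ` {1..2*k-1}"
  \<comment> \<open>A margin of one spacing of the zeros of sinh, so that the open strip widened by it
    contains no zeros beyond those in the closed strip.\<close>
  define \<epsilon> where "\<epsilon> = 1 / (2 * real k)"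
  define D where "D = {z. a * z * (z + \<i>) \<in> U} \<inter> {z. Im z > - 1 - \<epsilon>} \<inter> {z. Im z < \<epsilon>}"
  define Z where "Z = P \<union> {0, - \<i>}"
  have "c \<noteq> 0" "\<epsilon> > 0" using k by (auto simp: c_def \<epsilon>_def)
  have "open {z. a * z * (z + \<i>) \<in> U}"
  proof -
    have "open ((\<lambda>z. a * z * (z + \<i>)) -` U)"
      by (intro open_vimage U continuous_intros)
    then show ?thesis by (simp add: vimage_def)
  qed
  then have "open D"
    unfolding D_def by (intro open_Int open_halfspace_Im_gt open_halfspace_Im_lt)
  have "strip \<subseteq> D" using img \<open>\<epsilon> > 0\<close> by (auto simp: D_def strip_def image_subset_iff)
  have "finite P" by (simp add: P_def)
  then have "finite Z" by (simp add: Z_def)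
  have Pin: "Re q = 0 \<and> -1 < Im q \<and> Im q < 0" if "q \<in> P" for q
    using that k by (auto simp: P_def p_def field_simps Re_divide_of_nat Im_divide_of_nat
        simp flip: of_nat_mult)
  then have "P \<subseteq> strip" by (force simp: strip_def)
  have zeros: "sinh (c * z) = 0 \<Longrightarrow> z \<in> Z" if z: "z \<in> D" for z
  proof -
    assume "sinh (c * z) = 0"
    then obtain m :: int where m: "z = \<i> * of_int m / (2 * of_nat k)"
      using sinh_eq_0_iff[OF k] by (auto simp: c_def)
    have "Im z = of_int m / (2 * of_nat k)"
      using k by (simp add: m Im_divide_of_nat flip: of_nat_mult)
    then have "- 1 - \<epsilon> < of_int m / (2 * real k)" "of_int m / (2 * real k) < \<epsilon>"
      using z by (auto simp: D_def)
    moreover have "- 1 - \<epsilon> = (- (2 * real k) - 1) / (2 * real k)"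
      using k by (simp add: \<epsilon>_def field_simps)
    ultimately have "- (2 * real k) - 1 < of_int m" "of_int m < (1 :: real)"
      using k by (simp_all add: \<epsilon>_def divide_less_cancel)
    then have "- (2 * int k) \<le> m" "m \<le> 0" by linarith+
    then obtain n where n: "m = - int n" "n \<le> 2 * k"
      by (metis nat_le_iff minus_le_iff neg_0_le_iff_le nat_0_le minus_minus
          of_nat_le_iff of_nat_mult of_nat_numeral)
    have zn: "z = p n" using m n by (simp add: p_def)
    consider "n = 0" | "n = 2 * k" | "n \<in> {1..2*k-1}" using n by fastforce
    then show "z \<in> Z"
      by cases (use k zn in \<open>auto simp: Z_def P_def p_def\<close>)
  qed
  have fD: "f holomorphic_on D"
  proof -
    have "F holomorphic_on U" using F by (rule analytic_imp_holomorphic)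
    then have "(F \<circ> (\<lambda>z. a * z * (z + \<i>))) holomorphic_on D"
      by (intro holomorphic_on_compose_gen[where t = U] holomorphic_intros) (auto simp: D_def)
    then show ?thesis by (simp add: f_def[abs_def] o_def)
  qed
  have gD: "g holomorphic_on D - Z"
    unfolding g_def[abs_def]
    by (intro holomorphic_intros holomorphic_on_subset[OF fD]
        analytic_imp_holomorphic[where f = "\<lambda>z. sinh (c * z)"] analytic_intros) (use zeros in auto)
  have gan: "g analytic_on {z}" if "z \<in> D - Z" for z
    using gD that \<open>open D\<close> \<open>finite Z\<close>
    by (meson finite_imp_closed holomorphic_on_imp_analytic_at open_Diff)
  have iso: "isolated_singularity_at g z" if "z \<in> D" for z
  proof (rule isolated_singularity_at_holomorphic)
    show "g holomorphic_on (D - (Z - {z})) - {z}"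
      by (rule holomorphic_on_subset[OF gD]) auto
    show "open (D - (Z - {z}))"
      using \<open>open D\<close> \<open>finite Z\<close> by (simp add: finite_imp_closed open_Diff)
  qed (use that in auto)
  have "0 \<in> D" "- \<i> \<in> D" using \<open>strip \<subseteq> D\<close> by (auto simp: strip_def)
  have contf: "isCont f z" if "z \<in> D" for z
    using holomorphic_on_imp_continuous_on[OF fD] \<open>open D\<close> that
    by (simp add: continuous_on_eq_continuous_at)
  have "f 0 = 0"
  proof (rule tendsto_unique)
    show "(f \<longlongrightarrow> 0) (at 0 within strip)" using assms(6) by (simp add: f_def[abs_def])
    show "(f \<longlongrightarrow> f 0) (at 0 within strip)"
      using contf[OF \<open>0 \<in> D\<close>] by (metis isContD subset_UNIV tendsto_within_subset)
    have "(0::complex) islimpt strip"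
    proof (rule connected_imp_perfect)
      show "connected strip"
        by (rule convex_connected) (rule convex_strip)
      have "0 \<in> strip" "- \<i> \<in> strip" by (auto simp: strip_def)
      then show "strip \<noteq> {x}" for x
        by (metis singletonD neg_equal_0_iff_equal complex_i_not_zero)
    qed (simp add: strip_def)
    then show "at (0::complex) within strip \<noteq> bot" by (simp add: trivial_limit_within)
  qed
  obtain L where L: "g \<midarrow>0\<rightarrow> L"
  proof -
    have "(f has_field_derivative deriv f 0) (at 0)"
      using fD \<open>open D\<close> \<open>0 \<in> D\<close> by (rule holomorphic_derivI)
    then have "(\<lambda>z. f z / z) \<midarrow>0\<rightarrow> deriv f 0"
      by (simp add: has_field_derivative_iff \<open>f 0 = 0\<close>)
    from tendsto_mult[OF this sinh_simple_zero[of c 0]] \<open>c \<noteq> 0\<close>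
    have "(\<lambda>z. f z / z * (z / sinh (c * z))) \<midarrow>0\<rightarrow> deriv f 0 * (1 / c)" by simp
    moreover have "eventually (\<lambda>z. f z / z * (z / sinh (c * z)) = g z) (at 0)"
      unfolding eventually_at by (rule exI[of _ 1]) (auto simp: g_def)
    ultimately show ?thesis using that tendsto_cong by force
  qed
  have fsym: "f (- \<i> - z) = f z" for z
    by (simp add: f_def algebra_simps)
  have shift: "sinh (c * (\<i> + z)) = sinh (c * z)" for z
  proof -
    have "exp (c * \<i>) = 1"
      unfolding exp_eq_1 by (intro conjI exI[of _ "int k"]) (auto simp: c_def)
    then have "exp (c * (\<i> + z)) = exp (c * z)" by (simp add: distrib_left exp_add)
    then show ?thesis unfolding sinh_field_def exp_minus by (simp only:)
  qed
  have gsym: "g (- \<i> - z) = - g z" for z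
  proof -
    have "sinh (c * (- \<i> - z)) = sinh (c * (- z))"
      using shift[of "- \<i> - z"] by simp
    then show ?thesis by (simp add: g_def fsym)
  qed
  \<comment> \<open>The antisymmetry transports removability from one edge to the other.\<close>
  have L': "g \<midarrow>- \<i>\<rightarrow> - L"
  proof -
    have "filterlim (\<lambda>z. - \<i> - z) (at 0) (at (- \<i>))"
      by (rule filterlim_atI) (auto intro!: tendsto_eq_intros eventually_neq_at_within
           simp: eventually_at intro!: exI[of _ 1])
    from filterlim_compose[OF L this] have "(\<lambda>z. - g z) \<midarrow>- \<i>\<rightarrow> L" by (simp add: gsym)
    from tendsto_minus[OF this] show ?thesis by simp
  qed
  have hD: "h holomorphic_on D - P"
  proof -
    have "h analytic_on {z}" if z: "z \<in> D - P" for z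
    proof -
      consider "z = 0" | "z = - \<i>" | "z \<in> D - Z" using z by (auto simp: Z_def)
      then show ?thesis
      proof cases
        case 1 then show ?thesis unfolding h_def
          using remove_sings_analytic_at[OF iso L] \<open>0 \<in> D\<close> by simp
      next
        case 2 then show ?thesis unfolding h_def
          using remove_sings_analytic_at[OF iso L'] \<open>- \<i> \<in> D\<close> by simp
      next
        case 3 then show ?thesis unfolding h_def
          by (intro remove_sings_analytic_on gan)
      qed
    qed
    then show ?thesis
      using analytic_on_analytic_at analytic_imp_holomorphic by blast
  qed
  have heq: "h z = g z" if "z \<in> D - Z" for z
    using gan[OF that] by (simp add: h_def)
  have hsym: "h (of_real t - \<i>) = - h (of_real (- t))" for t
  proof (cases "t = 0")
    case True
    have "h 0 = L" "h (- \<i>) = - L"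
      using L L' by (auto simp: h_def)
    then show ?thesis using True by simp
  next
    case False
    have "complex_of_real (- t) \<in> D - Z" "complex_of_real t - \<i> \<in> D - Z"
      using False \<open>strip \<subseteq> D\<close> Pin by (force simp: Z_def strip_def complex_eq_iff)+
    moreover have "complex_of_real t - \<i> = - \<i> - of_real (- t)" by simp
    ultimately show ?thesis by (metis heq gsym)
  qed
  have hends: "(h \<longlongrightarrow> 0) strip_ends"
  proof -
    have "(g \<longlongrightarrow> 0) strip_ends"
      using quotient_sinh_tendsto_0[OF k, of f] assms(5)
      by (simp add: g_def[abs_def] c_def f_def[abs_def])
    moreover have "eventually (\<lambda>z. g z = h z) strip_ends"
      unfolding eventually_strip_ends
    proof (intro exI[of _ 1] ballI impI)
      fix z assume "z \<in> strip" "1 \<le> \<bar>Re z\<bar>"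
      moreover from this have "z \<notin> Z" using Pin by (force simp: Z_def)
      ultimately show "g z = h z" using heq \<open>strip \<subseteq> D\<close> by auto
    qed
    ultimately show ?thesis using tendsto_cong by force
  qed
  have injp: "inj_on p {1..2*k-1}"
    using k by (auto simp: inj_on_def p_def)
  have res: "residue h (p m) = (-1) ^ m * f (p m) / c" if m: "m \<in> {1..2*k-1}" for m
  proof -
    have "p m \<in> P" using m by (simp add: P_def)
    then have pD: "p m \<in> D" "p m \<in> P" using \<open>P \<subseteq> strip\<close> \<open>strip \<subseteq> D\<close> by auto
    have "sinh (c * p m) = 0"
      unfolding c_def sinh_eq_0_iff[OF k] by (rule exI[of _ "- int m"]) (simp add: p_def)
    moreover have "cosh (c * p m) = (-1) ^ m"
      unfolding c_def p_def by (rule cosh_at_zero_of_sinh[OF k])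
    ultimately have "(\<lambda>z. (z - p m) / sinh (c * z)) \<midarrow>p m\<rightarrow> 1 / (c * (-1) ^ m)"
      using sinh_simple_zero[OF \<open>c \<noteq> 0\<close>, of "p m"] by simp
    from tendsto_mult[OF isContD[OF contf[OF pD(1)]] this]
    have "(\<lambda>z. f z * ((z - p m) / sinh (c * z))) \<midarrow>p m\<rightarrow> f (p m) * (1 / (c * (-1) ^ m))" .
    then have lim: "(\<lambda>z. g z * (z - p m)) \<midarrow>p m\<rightarrow> (-1) ^ m * f (p m) / c"
      by (auto simp: g_def minus_one_power_iff split: if_splits)
    have "residue g (p m) = (-1) ^ m * f (p m) / c"
    proof (rule residue_simple'[OF _ _ _ lim])
      show "g holomorphic_on (D - (Z - {p m})) - {p m}"
        by (rule holomorphic_on_subset[OF gD]) auto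
      show "open (D - (Z - {p m}))"
        using \<open>open D\<close> \<open>finite Z\<close> by (simp add: finite_imp_closed open_Diff)
    qed (use pD in auto)
    then show ?thesis using iso[OF pD(1)] by (simp add: h_def)
  qed
  define S where "S = (\<Sum>n=1..k-1. (-1) ^ n *
      F (a * ((of_nat k)\<^sup>2 - (of_nat n)\<^sup>2) / (4 * (of_nat k)\<^sup>2)))"
  define V where "V = - (\<i> * (-1) ^ k / of_nat k) * (S + 1 / 2 * F (a / 4))"
  have fp1: "f (p (k + n)) = F (a * ((of_nat k)\<^sup>2 - (of_nat n)\<^sup>2) / (4 * (of_nat k)\<^sup>2))" for n
  proof -
    have "a * p (k + n) * (p (k + n) + \<i>) = a * ((of_nat k)\<^sup>2 - (of_nat n)\<^sup>2) / (4 * (of_nat k)\<^sup>2)"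
      using k by (simp add: p_def field_simps power2_eq_square)
    then show ?thesis by (simp add: f_def)
  qed
  have fp2: "f (p (k - n)) = f (p (k + n))" if "n < k" for n
  proof -
    have "p (k - n) = - \<i> - p (k + n)"
      using k that by (simp add: p_def field_simps of_nat_diff)
    then show ?thesis by (simp add: fsym)
  qed
  have fpk: "f (p k) = F (a / 4)" using fp1[of 0] k by simp
  have "(\<Sum>q\<in>P. residue h q) = (\<Sum>m=1..2*k-1. residue h (p m))"
    unfolding P_def using injp by (simp add: sum.reindex)
  also have "\<dots> = (\<Sum>m=1..2*k-1. (-1) ^ m * f (p m)) / c"
    unfolding sum_divide_distrib by (intro sum.cong refl) (use res in auto)
  also have "\<dots> = (-1) ^ k * (F (a / 4) + 2 * S) / c"
    using sum_alternating_symmetric[OF k, of "\<lambda>m. f (p m)"] fp2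
    by (simp add: S_def fp1 fpk)
  finally have V: "- (of_real pi * \<i> * (\<Sum>q\<in>P. residue h q)) = V"
    using k by (simp add: V_def c_def field_simps)
  have line: "has_line_integral g V"
    unfolding has_line_integral_def
    using strip_integral[OF \<open>open D\<close> \<open>strip \<subseteq> D\<close> \<open>finite P\<close> hD Pin hsym hends] V
    by (auto simp: h_def)
  have 1: "(\<lambda>x. F (a * x * (\<i> + x)) / sinh (2 * of_nat k * of_real pi * x)) = g"
    by (simp add: g_def[abs_def] f_def c_def add.commute)
  have 2: "(\<lambda>x. F (a * x * (\<i> + x)) / sinh (2 * of_nat k * of_real pi * (\<i> + x))) = g"
    using shift by (simp add: g_def[abs_def] f_def c_def add.commute)
  show ?thesis
    unfolding Let_def 1 2 using line by (simp add: V_def S_def)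
qed

end
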